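(* For every positive integer $n$, let $D'_n$ be the digraph with vertex set $K(D'_n)\cup I(D'_n)$, where \[ K(D'_n) = \{k_0,\ldots,k_{2n}\},\qquad I(D'_n)=\{s_{ij}\colon 0\leq i\leq 2n,\ 1\leq j\leq n\}, \] (all these vertices being distinct) and with arc set \[ \begin{aligned} A(D'_n)={}&\{(k_i,k_{i+j})\colon 0\leq i\leq 2n,\ 1\leq j\leq n\}\cup\{(s_{ij},k_i)\colon 0\leq i\leq 2n,\ 1\leq j\leq n\}\\ &\cup\{(k_0,s_{ij})\colon 1\leq i\leq 2n,\ 1\leq j\leq n\}, \end{aligned} \] where the sum $i+j$ in the index of $k_{i+j}$ is taken modulo $2n+1$. Denote by $Q'_n$ a smallest quasi-kernel of $D'_n$. Then \[ \lim_{n\to+\infty}\frac{|Q'_n|}{|V(D'_n)|}=\frac{1}{2}. \]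
   Context: A quasi-kernel of a digraph $D$ is an independent set $Q\subseteq V(D)$ (no arc between any two vertices of $Q$) such that from every vertex of $D$ there is a directed path of length at most two to some vertex of $Q$ (length zero for vertices of $Q$). Every finite digraph has a quasi-kernel, so a smallest one (a quasi-kernel of minimum cardinality) exists. *)

theory Defs
  imports Complex_Main "Graph_Theory.Pair_Digraph"
begin

definition independent_in :: "('a, 'b) pre_digraph \<Rightarrow> 'a set \<Rightarrow> bool" where
  "independent_in G Q \<longleftrightarrow> Q \<subseteq> verts G \<and> (\<forall>u\<in>Q. \<forall>v\<in>Q. \<not> u \<rightarrow>\<^bsub>G\<^esub> v)"

(* A path is given by its list of arcs, so length p is the number of arcs, and the empty
   list is the path of length zero from a vertex to itself. *)
definition quasi_kernel :: "('a, 'b) pre_digraph \<Rightarrow> 'a set \<Rightarrow> bool" where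
  "quasi_kernel G Q \<longleftrightarrow>
     independent_in G Q \<and>
     (\<forall>u\<in>verts G. \<exists>v\<in>Q. \<exists>p. pre_digraph.apath G u p v \<and> length p \<le> 2)"

definition smallest_quasi_kernel :: "('a, 'b) pre_digraph \<Rightarrow> 'a set \<Rightarrow> bool" where
  "smallest_quasi_kernel G Q \<longleftrightarrow> is_arg_min card (quasi_kernel G) Q"

(* Kv i and Sv i j stand for k_i and s_{ij}. *)
datatype vertex = Kv nat | Sv nat nat

definition K_part :: "nat \<Rightarrow> vertex set" where
  "K_part n = {Kv i | i. i \<le> 2 * n}"

definition I_part :: "nat \<Rightarrow> vertex set" where
  "I_part n = {Sv i j | i j. i \<le> 2 * n \<and> 1 \<le> j \<and> j \<le> n}"

definition D' :: "nat \<Rightarrow> vertex pair_pre_digraph" where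
  "D' n = \<lparr>
     pverts = K_part n \<union> I_part n,
     parcs =
       {(Kv i, Kv ((i + j) mod (2 * n + 1))) | i j. i \<le> 2 * n \<and> 1 \<le> j \<and> j \<le> n}
       \<union> {(Sv i j, Kv i) | i j. i \<le> 2 * n \<and> 1 \<le> j \<and> j \<le> n}
       \<union> {(Kv 0, Sv i j) | i j. 1 \<le> i \<and> i \<le> 2 * n \<and> 1 \<le> j \<and> j \<le> n} \<rparr>"

end

theory Submission
  imports Defs "HOL-Real_Asymp.Real_Asymp"
begin

text \<open>The vertices \<open>k\<^sub>i\<close> induce a tournament, so a quasi-kernel contains at most one of them. A vertex
  \<open>s\<^sub>i\<^sub>j\<close> with \<open>i \<noteq> 0\<close> only sees \<open>k\<^sub>i\<close> and its out-neighbours within two steps, so a quasi-kernel with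
  \<open>k\<^sub>i\<close> must contain \<open>s\<^sub>l\<^sub>j\<close> for every \<open>l \<noteq> 0\<close> among the \<open>n\<close> out-neighbours of \<open>i\<close>, which gives
  \<open>n (n - 1)\<close> vertices at least; one without any \<open>k\<^sub>i\<close> contains all \<open>s\<^sub>l\<^sub>j\<close> with \<open>l \<noteq> 0\<close>. Conversely \<open>k\<^sub>1\<close> with the \<open>s\<^sub>l\<^sub>j\<close> for \<open>l\<close> an out-neighbour of \<open>1\<close> is a
  quasi-kernel with \<open>n\<^sup>2 + 1\<close> vertices; it is independent because only \<open>k\<^sub>0\<close> has arcs to the
  \<open>s\<^sub>i\<^sub>j\<close>. The digraph has \<open>(2 n + 1) (n + 1)\<close> vertices.\<close>

text \<open>Replaces arc-list paths by the arc relation, so that later arguments only inspect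
  arcs.\<close>

lemma short_apath_iff:
  "(\<exists>p. pre_digraph.apath G u p v \<and> length p \<le> 2) \<longleftrightarrow>
     u \<in> verts G \<and> (u = v \<or> u \<rightarrow>\<^bsub>G\<^esub> v \<or> (\<exists>w. u \<rightarrow>\<^bsub>G\<^esub> w \<and> w \<rightarrow>\<^bsub>G\<^esub> v))"
    (is "?L \<longleftrightarrow> ?R")
proof
  assume ?L
  then obtain p where p: "pre_digraph.apath G u p v" "length p \<le> 2" by blast
  then have w: "u \<in> verts G" "set p \<subseteq> arcs G" "pre_digraph.cas G u p v"
    by (auto simp: pre_digraph.apath_def pre_digraph.awalk_def)
  consider "p = []" | a where "p = [a]" | a b where "p = [a, b]"
    using p(2) by (cases p; cases "tl p"; cases "tl (tl p)") auto
  then show ?R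
    using w by cases (auto simp: pre_digraph.cas.simps arcs_ends_def arc_to_ends_def)
next
  assume R: ?R
  then have u: "u \<in> verts G" by blast
  show ?L
  proof (cases "u = v")
    case True
    then show ?thesis using u
      by (intro exI[of _ "[]"])
        (auto simp: pre_digraph.apath_def pre_digraph.awalk_def pre_digraph.cas.simps
          pre_digraph.awalk_verts.simps)
  next
    case uv: False
    show ?thesis
    proof (cases "u \<rightarrow>\<^bsub>G\<^esub> v")
      case True
      then obtain a where "a \<in> arcs G" "tail G a = u" "head G a = v"
        by (auto simp: arcs_ends_def arc_to_ends_def)
      then show ?thesis using u uv
        by (intro exI[of _ "[a]"])
          (auto simp: pre_digraph.apath_def pre_digraph.awalk_def pre_digraph.cas.simps
            pre_digraph.awalk_verts.simps)
    next
      case False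
      then obtain w where w: "u \<rightarrow>\<^bsub>G\<^esub> w" "w \<rightarrow>\<^bsub>G\<^esub> v" using R uv by blast
      \<comment> \<open>An \<open>apath\<close> may not repeat vertices. Since there is no arc from
        \<open>u\<close> to \<open>v\<close>, the midpoint differs from both ends.\<close>
      then have "w \<noteq> u" "w \<noteq> v" using False by auto
      moreover obtain a b where "a \<in> arcs G" "tail G a = u" "head G a = w"
          "b \<in> arcs G" "tail G b = w" "head G b = v"
        using w by (auto simp: arcs_ends_def arc_to_ends_def)
      ultimately show ?thesis using u uv
        by (intro exI[of _ "[a, b]"])
          (auto simp: pre_digraph.apath_def pre_digraph.awalk_def pre_digraph.cas.simps
            pre_digraph.awalk_verts.simps)
    qed
  qed
qed

lemma quasi_kernel_iff:
  "quasi_kernel G Q \<longleftrightarrow> independent_in G Q \<and>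
     (\<forall>u\<in>verts G. \<exists>v\<in>Q. u = v \<or> u \<rightarrow>\<^bsub>G\<^esub> v \<or> (\<exists>w. u \<rightarrow>\<^bsub>G\<^esub> w \<and> w \<rightarrow>\<^bsub>G\<^esub> v))"
  unfolding quasi_kernel_def short_apath_iff by blast

lemma mod_upto_double:
  fixes a m :: nat
  assumes "a < 2 * m"
  shows "a mod m = (if a < m then a else a - m)"
  using assms by (simp add: mod_if)

lemma D'_verts:
  "Kv i \<in> pverts (D' n) \<longleftrightarrow> i \<le> 2 * n"
  "Sv i j \<in> pverts (D' n) \<longleftrightarrow> i \<le> 2 * n \<and> 1 \<le> j \<and> j \<le> n"
  by (auto simp: D'_def K_part_def I_part_def)

text \<open>Splitting the cyclic condition into no wrap-around (\<open>a < b\<close>) and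
  wrap-around (\<open>b + n < a\<close>) leaves only linear inequalities.\<close>

lemma D'_arcs:
  "(Kv a, Kv b) \<in> parcs (D' n) \<longleftrightarrow>
     a \<le> 2 * n \<and> b \<le> 2 * n \<and> (a < b \<and> b \<le> a + n \<or> b + n < a)"
  "(Sv i j, Kv b) \<in> parcs (D' n) \<longleftrightarrow> b = i \<and> i \<le> 2 * n \<and> 1 \<le> j \<and> j \<le> n"
  "(Kv a, Sv i j) \<in> parcs (D' n) \<longleftrightarrow> a = 0 \<and> 1 \<le> i \<and> i \<le> 2 * n \<and> 1 \<le> j \<and> j \<le> n"
  "(Sv i j, Sv l m) \<notin> parcs (D' n)"
proof -
  have "(\<exists>j. b = (a + j) mod (2 * n + 1) \<and> a \<le> 2 * n \<and> 1 \<le> j \<and> j \<le> n) \<longleftrightarrow>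
     a \<le> 2 * n \<and> b \<le> 2 * n \<and> (a < b \<and> b \<le> a + n \<or> b + n < a)" (is "?L \<longleftrightarrow> ?R")
  proof
    assume ?L
    then obtain j where "b = (a + j) mod (2 * n + 1)" "a \<le> 2 * n" "1 \<le> j" "j \<le> n" by blast
    then show ?R using mod_upto_double[of "a + j" "2 * n + 1"] by (auto split: if_splits)
  next
    assume R: ?R
    show ?L
    proof (cases "a < b")
      case True
      then show ?thesis using R by (intro exI[of _ "b - a"]) auto
    next
      case False
      then show ?thesis using R mod_upto_double[of "2 * n + 1 + b" "2 * n + 1"]
        \<comment> \<open>The step from \<open>a\<close> to \<open>b\<close> once around the cycle;
          it is at most \<open>n\<close> exactly when \<open>b + n < a\<close>.\<close>
        by (intro exI[of _ "2 * n + 1 + b - a"]) auto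
    qed
  qed
  then show "(Kv a, Kv b) \<in> parcs (D' n) \<longleftrightarrow>
     a \<le> 2 * n \<and> b \<le> 2 * n \<and> (a < b \<and> b \<le> a + n \<or> b + n < a)"
    by (auto simp: D'_def)
qed (auto simp: D'_def)

lemma card_Sv_image: "card ((\<lambda>(l, j). Sv l j) ` (L \<times> {1..n})) = card L * n"
  by (subst card_image) (auto simp: inj_on_def card_cartesian_product)

lemma D'_pverts_eq:
  "pverts (D' n) = Kv ` {..2 * n} \<union> (\<lambda>(l, j). Sv l j) ` ({..2 * n} \<times> {1..n})"
  by (auto simp: D'_def K_part_def I_part_def)

lemma finite_D'_verts: "finite (pverts (D' n))"
  by (simp add: D'_pverts_eq)

lemma card_D'_verts: "card (pverts (D' n)) = (2 * n + 1) * (n + 1)"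
  unfolding D'_pverts_eq
  by (subst card_Un_disjoint) (auto simp: card_image inj_on_def card_Sv_image)

lemma D'_quasi_kernel_small:
  assumes "n \<ge> 1"
  shows "quasi_kernel (with_proj (D' n))
    (insert (Kv 1) ((\<lambda>(l, j). Sv l j) ` ({2..n + 1} \<times> {1..n})))" (is "quasi_kernel _ ?Q")
  unfolding quasi_kernel_iff
proof
  show "independent_in (with_proj (D' n)) ?Q"
    using assms by (auto simp: independent_in_def D'_verts D'_arcs)
  show "\<forall>u\<in>verts (with_proj (D' n)). \<exists>v\<in>?Q. u = v \<or> u \<rightarrow>\<^bsub>with_proj (D' n)\<^esub> v \<or>
      (\<exists>w. u \<rightarrow>\<^bsub>with_proj (D' n)\<^esub> w \<and> w \<rightarrow>\<^bsub>with_proj (D' n)\<^esub> v)"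
  proof
    fix u assume "u \<in> verts (with_proj (D' n))"
    then have u: "u \<in> pverts (D' n)" by simp
    let ?P = "\<lambda>v. u = v \<or> (u, v) \<in> parcs (D' n) \<or>
      (\<exists>w. (u, w) \<in> parcs (D' n) \<and> (w, v) \<in> parcs (D' n))"
    have "\<exists>v\<in>?Q. ?P v"
    proof (cases u)
      case (Kv l)
      then have l: "l \<le> 2 * n" using u by (simp add: D'_verts)
      have "?P (Kv 1)"
      proof (cases "l \<in> {2..n + 1}")
        case True
        \<comment> \<open>The index \<open>n + 2\<close> modulo \<open>2 * n + 1\<close>: the first
          one past the out-neighbours of 1, hence a common out-neighbour of all of them, with an arc
          back to 1.\<close>
        define m where "m = (if n = 1 then 0 else n + 2)"
        have "(Kv l, Kv m) \<in> parcs (D' n)" "(Kv m, Kv 1) \<in> parcs (D' n)"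
          using True assms by (auto simp: D'_arcs m_def)
        then show ?thesis using Kv by blast
      next
        case False
        then show ?thesis using l Kv assms by (auto simp: D'_arcs)
      qed
      then show ?thesis by blast
    next
      case (Sv l j)
      then have l: "l \<le> 2 * n" "1 \<le> j" "j \<le> n" using u by (simp_all add: D'_verts)
      show ?thesis
      proof (cases "l \<in> {2..n + 1}")
        case True
        then have "u \<in> ?Q" using Sv l by auto
        then show ?thesis by blast
      next
        case False
        \<comment> \<open>The remaining indices are 0, 1 and those from \<open>n + 2\<close> on; all
          but 1 are in-neighbours of 1.\<close>
        then have "l = 1 \<or> (Kv l, Kv 1) \<in> parcs (D' n)"
          using l assms by (auto simp: D'_arcs)
        moreover have "(Sv l j, Kv l) \<in> parcs (D' n)" using l by (simp add: D'_arcs)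
        ultimately have "?P (Kv 1)" using Sv by blast
        then show ?thesis by blast
      qed
    qed
    then show "\<exists>v\<in>?Q. u = v \<or> u \<rightarrow>\<^bsub>with_proj (D' n)\<^esub> v \<or>
      (\<exists>w. u \<rightarrow>\<^bsub>with_proj (D' n)\<^esub> w \<and> w \<rightarrow>\<^bsub>with_proj (D' n)\<^esub> v)"
      by simp
  qed
qed

lemma D'_quasi_kernel_card_ge:
  assumes qk: "quasi_kernel (with_proj (D' n)) Q"
  shows "(n - 1) * n \<le> card Q"
proof -
  have ind: "\<And>u v. u \<in> Q \<Longrightarrow> v \<in> Q \<Longrightarrow> (u, v) \<notin> parcs (D' n)"
    and sub: "Q \<subseteq> pverts (D' n)"
    and dom: "\<And>u. u \<in> pverts (D' n) \<Longrightarrow> \<exists>v\<in>Q. u = v \<or> (u, v) \<in> parcs (D' n) \<or>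
      (\<exists>w. (u, w) \<in> parcs (D' n) \<and> (w, v) \<in> parcs (D' n))"
    using qk by (auto simp: quasi_kernel_iff independent_in_def)
  \<comment> \<open>The only way out of \<open>Sv l j\<close> is through \<open>Kv l\<close>, which
    for \<open>l \<ge> 1\<close> has no arc back into the \<open>Sv\<close> vertices.\<close>
  have S_dom: "Sv l j \<in> Q \<or> Kv l \<in> Q \<or> (\<exists>b. Kv b \<in> Q \<and> (Kv l, Kv b) \<in> parcs (D' n))"
    if l: "1 \<le> l" "l \<le> 2 * n" "1 \<le> j" "j \<le> n" for l j
  proof -
    have S_out: "w = Kv l" if "(Sv l j, w) \<in> parcs (D' n)" for w
      using that by (cases w) (auto simp: D'_arcs)
    have K_out: "\<exists>b. w = Kv b" if "(Kv l, w) \<in> parcs (D' n)" for w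
      using that l by (cases w) (auto simp: D'_arcs)
    obtain v where "v \<in> Q" "Sv l j = v \<or> (Sv l j, v) \<in> parcs (D' n) \<or>
      (\<exists>w. (Sv l j, w) \<in> parcs (D' n) \<and> (w, v) \<in> parcs (D' n))"
      using dom[of "Sv l j"] l by (auto simp: D'_verts)
    then show ?thesis using S_out K_out by blast
  qed
  have "\<exists>L. n - 1 \<le> card L \<and> (\<lambda>(l, j). Sv l j) ` (L \<times> {1..n}) \<subseteq> Q"
  proof (cases "\<exists>i. Kv i \<in> Q")
    case False
    then have "(\<lambda>(l, j). Sv l j) ` ({1..2 * n} \<times> {1..n}) \<subseteq> Q"
      using S_dom by fastforce
    then show ?thesis by (intro exI[of _ "{1..2 * n}"]) simp
  next
    case True
    then obtain i where i: "Kv i \<in> Q" by blast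
    then have i_le: "i \<le> 2 * n" using sub by (auto simp: D'_verts)
    \<comment> \<open>Two distinct \<open>Kv\<close> vertices are joined by an arc in one direction,
      against independence.\<close>
    have uniq: "b = i" if "Kv b \<in> Q" for b
    proof -
      have "b \<le> 2 * n" using that sub by (auto simp: D'_verts)
      then show ?thesis
        using ind[OF that i] ind[OF i that] i_le by (auto simp: D'_arcs)
    qed
    \<comment> \<open>The out-neighbours of \<open>i\<close> other than 0, without and with
      wrap-around. Dropping 0 costs one index when \<open>i > n\<close>; for
      \<open>i \<le> n\<close> the second interval is empty.\<close>
    define L where "L = {i + 1..min (2 * n) (i + n)} \<union> {1..<i - n}"
    have "card L = card {i + 1..min (2 * n) (i + n)} + card {1..<i - n}"
      unfolding L_def by (rule card_Un_disjoint) auto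
    then have "n - 1 \<le> card L" using i_le by simp
    moreover have "Sv l j \<in> Q" if "l \<in> L" "j \<in> {1..n}" for l j
    proof -
      have "1 \<le> l" "l \<le> 2 * n" "l \<noteq> i" "(Kv l, Kv i) \<notin> parcs (D' n)"
        using that(1) i_le unfolding L_def D'_arcs by auto
      \<comment> \<open>By \<open>uniq\<close>, the other two alternatives would force
        \<open>l = i\<close> or an arc from \<open>Kv l\<close> to \<open>Kv i\<close>.\<close>
      then show ?thesis using S_dom[of l j] uniq that(2) by auto
    qed
    ultimately show ?thesis by (intro exI[of _ L]) auto
  qed
  then obtain L where L: "n - 1 \<le> card L" "(\<lambda>(l, j). Sv l j) ` (L \<times> {1..n}) \<subseteq> Q" by blast
  have "(n - 1) * n \<le> card ((\<lambda>(l, j). Sv l j) ` (L \<times> {1..n}))"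
    unfolding card_Sv_image using L(1) by simp
  also have "\<dots> \<le> card Q"
    using L(2) finite_subset[OF sub finite_D'_verts] by (rule card_mono[rotated])
  finally show ?thesis .
qed

lemma D'_smallest_quasi_kernel_card_le:
  assumes "n \<ge> 1" and "smallest_quasi_kernel (with_proj (D' n)) Q"
  shows "card Q \<le> n * n + 1"
proof -
  have "card Q \<le> card (insert (Kv 1) ((\<lambda>(l, j). Sv l j) ` ({2..n + 1} \<times> {1..n})))"
    using assms D'_quasi_kernel_small[OF assms(1)]
    unfolding smallest_quasi_kernel_def is_arg_min_linorder by blast
  also have "\<dots> \<le> Suc (card ((\<lambda>(l, j). Sv l j) ` ({2..n + 1} \<times> {1..n})))"
    by (rule card_insert_le_m1) auto
  also have "\<dots> = n * n + 1"
    by (simp only: card_Sv_image) simp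
  finally show ?thesis .
qed

theorem proposition2p2:
  fixes Q' :: "nat \<Rightarrow> vertex set"
  assumes "\<And>n. n \<ge> 1 \<Longrightarrow> smallest_quasi_kernel (with_proj (D' n)) (Q' n)"
  shows "(\<lambda>n. real (card (Q' n)) / real (card (pverts (D' n)))) \<longlonglongrightarrow> 1 / 2"
proof (rule tendsto_sandwich)
  let ?V = "\<lambda>n::nat. (2 * real n + 1) * (real n + 1)"
  have V: "real (card (pverts (D' n))) = ?V n" for n
    by (simp add: card_D'_verts algebra_simps)
  show "\<forall>\<^sub>F n in sequentially.
      (real n - 1) * real n / ?V n \<le> real (card (Q' n)) / real (card (pverts (D' n)))"
  \<comment> \<open>From 1 on the hypothesis applies, and the truncated \<open>n - 1\<close> agrees
    with the real difference.\<close>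
  proof (rule eventually_sequentiallyI[of 1])
    fix n :: nat assume n: "1 \<le> n"
    have "quasi_kernel (with_proj (D' n)) (Q' n)"
      using assms[OF n] by (simp add: smallest_quasi_kernel_def is_arg_min_def)
    from D'_quasi_kernel_card_ge[OF this] have "real ((n - 1) * n) \<le> real (card (Q' n))"
      by (rule of_nat_mono)
    then show "(real n - 1) * real n / ?V n \<le> real (card (Q' n)) / real (card (pverts (D' n)))"
      unfolding V using n by (intro divide_right_mono) (auto simp: of_nat_diff)
  qed
  show "\<forall>\<^sub>F n in sequentially.
      real (card (Q' n)) / real (card (pverts (D' n))) \<le> (real n * real n + 1) / ?V n"
  proof (rule eventually_sequentiallyI[of 1])
    fix n :: nat assume n: "1 \<le> n"
    from D'_smallest_quasi_kernel_card_le[OF n assms[OF n]]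
    have "real (card (Q' n)) \<le> real (n * n + 1)"
      by (rule of_nat_mono)
    then show "real (card (Q' n)) / real (card (pverts (D' n))) \<le> (real n * real n + 1) / ?V n"
      unfolding V by (intro divide_right_mono) auto
  qed
  show "(\<lambda>n. (real n - 1) * real n / ?V n) \<longlonglongrightarrow> 1 / 2"
    by real_asymp
  show "(\<lambda>n. (real n * real n + 1) / ?V n) \<longlonglongrightarrow> 1 / 2"
    by real_asymp
qed

end
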